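(* Let $G$ be a finite simple graph of order $n$ ($n\geq 2$), and let $S$ be a set of independent (pairwise non-adjacent) vertices in $G$ such that $|S|=\sigma$, $1\leq\sigma\leq n-1$. Let $G_S$ be the graph obtained by attaching a loop at each vertex in the set $S$. Then $$\mathcal{E}(G\setminus S) < \mathcal{E}(G_S),$$ where $G\setminus S$ is the graph obtained from $G$ by deleting all vertices of $S$.
   Context: The order of a graph is its number of vertices. For a simple graph $H$ of order $p$ with adjacency eigenvalues $\lambda_1(H),\dots,\lambda_p(H)$, the energy is $\mathcal{E}(H)=\sum_{i=1}^p|\lambda_i(H)|$. For a simple graph $G$ of order $n$ and $S\subseteq V(G)$ with $|S|=\sigma$, the self-loop graph $G_S$ has adjacency matrix $A(G_S)=A(G)+\mathfrak{I}_S$, where $A(G)$ is the adjacency matrix of $G$ and $\mathfrak{I}_S$ is the diagonal $0/1$ matrix with ones exactly at the positions corresponding to $S$. With $\lambda_1(G_S)\ge\cdots\ge\lambda_n(G_S)$ the eigenvalues of $A(G_S)$, the energy of $G_S$ is $\mathcal{E}(G_S)=\sum_{i=1}^n\left|\lambda_i(G_S)-\frac{\sigma}{n}\right|$. *)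

theory Defs
  imports
    "Jordan_Normal_Form.Char_Poly"
    "Graph_Theory.Digraph_Component"
begin

text \<open>
  Finite simple graphs are represented by the locale \<^locale>\<open>graph\<close>: finite, symmetric, loop-free
  digraphs without parallel arcs, so an undirected edge is a pair of opposite arcs.
\<close>

definition independent_set :: "('a, 'b) pre_digraph \<Rightarrow> 'a set \<Rightarrow> bool" where
  "independent_set G S \<longleftrightarrow>
     S \<subseteq> verts G \<and> (\<forall>u\<in>S. \<forall>v\<in>S. \<not> u \<rightarrow>\<^bsub>G\<^esub> v)"

definition delete_verts :: "('a, 'b) pre_digraph \<Rightarrow> 'a set \<Rightarrow> ('a, 'b) pre_digraph" where
  "delete_verts G S = G \<restriction> (verts G - S)"

text \<open>
  Matrices are indexed by natural numbers, so the adjacency matrices below are taken with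
  respect to an enumeration \<open>vs\<close> of the vertices; \<open>vertex_list\<close> chooses one arbitrarily.
  The lemma \<open>char_poly_adjacency_enum\<close> shows that the spectrum does not depend on the choice.
\<close>

definition vertex_list :: "('a, 'b) pre_digraph \<Rightarrow> 'a list" where
  "vertex_list G = (SOME vs. distinct vs \<and> set vs = verts G)"

definition adjacency_mat :: "('a, 'b) pre_digraph \<Rightarrow> 'a list \<Rightarrow> real mat" where
  "adjacency_mat G vs =
     mat (length vs) (length vs) (\<lambda>(i, j). if vs ! i \<rightarrow>\<^bsub>G\<^esub> vs ! j then 1 else 0)"

definition loop_mat :: "'a set \<Rightarrow> 'a list \<Rightarrow> real mat" where
  "loop_mat S vs =
     mat (length vs) (length vs) (\<lambda>(i, j). if i = j \<and> vs ! i \<in> S then 1 else 0)"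

definition self_loop_adjacency_mat ::
    "('a, 'b) pre_digraph \<Rightarrow> 'a set \<Rightarrow> 'a list \<Rightarrow> real mat" where
  "self_loop_adjacency_mat G S vs = adjacency_mat G vs + loop_mat S vs"

text \<open>
  Eigenvalues with algebraic multiplicity. Only real roots are collected; for a symmetric matrix
  these are all of them, see \<open>char_poly_symmetric_splits\<close> below.
\<close>

definition eigenvalues :: "real mat \<Rightarrow> real multiset" where
  "eigenvalues A = proots (char_poly A)"

definition graph_energy :: "('a, 'b) pre_digraph \<Rightarrow> real" where
  "graph_energy G = (\<Sum>x\<in>#eigenvalues (adjacency_mat G (vertex_list G)). \<bar>x\<bar>)"

definition self_loop_energy :: "('a, 'b) pre_digraph \<Rightarrow> 'a set \<Rightarrow> real" where
  "self_loop_energy G S =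
     (\<Sum>x\<in>#eigenvalues (self_loop_adjacency_mat G S (vertex_list G)).
        \<bar>x - real (card S) / real (card (verts G))\<bar>)"


lemma vertex_list:
  assumes "finite (verts G)"
  shows "distinct (vertex_list G)" and "set (vertex_list G) = verts G"
proof -
  have "\<exists>vs. distinct vs \<and> set vs = verts G"
    using finite_distinct_list[OF assms] by blast
  from someI_ex[OF this] show "distinct (vertex_list G)" "set (vertex_list G) = verts G"
    unfolding vertex_list_def by blast+
qed

lemma det_reindex:
  fixes A :: "'r :: comm_ring_1 mat"
  assumes A: "A \<in> carrier_mat n n" and p: "p permutes {0..<n}"
  shows "det (mat n n (\<lambda>(i, j). A $$ (p i, p j))) = det A"
proof -
  have lt: "p i < n" if "i < n" for i
    using permutes_in_image[OF p, of i] that by simp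
  define B where "B = mat n n (\<lambda>(i, j). transpose_mat A $$ (p i, j))"
  have B: "B \<in> carrier_mat n n" by (simp add: B_def)
  have "mat n n (\<lambda>(i, j). A $$ (p i, p j)) =
      mat n n (\<lambda>(i, j). transpose_mat B $$ (p i, j))"
    using A lt by (intro eq_matI) (auto simp: B_def)
  then have "det (mat n n (\<lambda>(i, j). A $$ (p i, p j))) = signof p * det (transpose_mat B)"
    using det_permute_rows[of "transpose_mat B" n p] B p by simp
  also have "det (transpose_mat B) = signof p * det (transpose_mat A)"
    unfolding det_transpose[OF B] unfolding B_def using A p by (intro det_permute_rows) auto
  also have "det (transpose_mat A) = det A" by (rule det_transpose[OF A])
  also have "signof p * (signof p * det A) = det A"
    by (cases p rule: sign_cases) simp_all
  finally show ?thesis .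
qed

lemma char_poly_enum:
  fixes f :: "'a \<Rightarrow> 'a \<Rightarrow> 'r :: comm_ring_1"
  assumes "distinct xs" "distinct ys" "set xs = set ys"
  shows "char_poly (mat (length xs) (length xs) (\<lambda>(i, j). f (xs ! i) (xs ! j))) =
    char_poly (mat (length ys) (length ys) (\<lambda>(i, j). f (ys ! i) (ys ! j)))"
    (is "char_poly ?X = char_poly ?Y")
proof -
  have len: "length xs = length ys"
    using assms by (metis distinct_card)
  have "mset xs = mset ys"
    using assms set_eq_iff_mset_eq_distinct by blast
  then obtain p where p: "p permutes {..<length ys}" and xs: "permute_list p ys = xs"
    by (rule mset_eq_permutation)
  let ?n = "length ys"
  have p': "p permutes {0..<?n}" using p by (simp add: lessThan_atLeast0)
  have lt: "p i < ?n" if "i < ?n" for i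
    using permutes_in_image[OF p, of i] that by simp
  have nth: "xs ! i = ys ! p i" if "i < ?n" for i
    using permute_list_nth[OF p that] xs by simp
  have inj: "p i = p j \<longleftrightarrow> i = j" for i j
    using permutes_inj[OF p] by (auto dest: injD)
  have "char_poly_matrix ?X = mat ?n ?n (\<lambda>(i, j). char_poly_matrix ?Y $$ (p i, p j))"
    by (intro eq_matI) (auto simp: char_poly_matrix_def len nth lt inj)
  then show ?thesis
    unfolding char_poly_def using det_reindex[OF _ p', of "char_poly_matrix ?Y"]
    by (simp add: char_poly_matrix_def)
qed

lemma char_poly_adjacency_enum:
  assumes "distinct vs" "distinct ws" "set vs = set ws"
  shows "char_poly (adjacency_mat G vs) = char_poly (adjacency_mat G ws)"
    and "char_poly (self_loop_adjacency_mat G S vs) = char_poly (self_loop_adjacency_mat G S ws)"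
proof -
  let ?a = "\<lambda>u v. (if u \<rightarrow>\<^bsub>G\<^esub> v then 1 else 0) :: real"
  let ?l = "\<lambda>u v. (if u = v \<and> u \<in> S then 1 else 0) :: real"
  show "char_poly (adjacency_mat G vs) = char_poly (adjacency_mat G ws)"
    unfolding adjacency_mat_def by (rule char_poly_enum[OF assms, of ?a])
  have eq: "self_loop_adjacency_mat G S xs =
      mat (length xs) (length xs) (\<lambda>(i, j). ?a (xs ! i) (xs ! j) + ?l (xs ! i) (xs ! j))"
    if "distinct xs" for xs
    using that
    by (intro eq_matI)
       (auto simp: self_loop_adjacency_mat_def adjacency_mat_def loop_mat_def nth_eq_iff_index_eq)
  show "char_poly (self_loop_adjacency_mat G S vs) = char_poly (self_loop_adjacency_mat G S ws)"
    unfolding eq[OF assms(1)] eq[OF assms(2)]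
    by (rule char_poly_enum[OF assms, of "\<lambda>u v. ?a u v + ?l u v"])
qed

lemma symmetric_real_eigenvalue:
  fixes A :: "real mat" and z :: complex
  assumes A: "A \<in> carrier_mat n n" and sym: "transpose_mat A = A"
    and z: "eigenvalue (map_mat of_real A) z"
  shows "z \<in> \<real>"
proof -
  let ?A = "map_mat of_real A :: complex mat"
  have entry: "A $$ (j, i) = A $$ (i, j)" if "i < n" "j < n" for i j
    using that A arg_cong[OF sym, of "\<lambda>M. M $$ (i, j)"] by simp
  from z obtain v where v: "v \<in> carrier_vec n" "v \<noteq> 0\<^sub>v n" and ev: "?A *\<^sub>v v = z \<cdot>\<^sub>v v"
    unfolding eigenvalue_def eigenvector_def using A by auto
  have row: "(\<Sum>j<n. of_real (A $$ (i, j)) * v $ j) = z * v $ i" if "i < n" for i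
    using arg_cong[OF ev, of "\<lambda>w. w $ i"] that A v
    by (simp add: scalar_prod_def lessThan_atLeast0)
  define N where "N = (\<Sum>i<n. cnj (v $ i) * v $ i)"
  define Q where "Q = (\<Sum>i<n. \<Sum>j<n. of_real (A $$ (i, j)) * cnj (v $ i) * v $ j)"
  have "Q = (\<Sum>i<n. cnj (v $ i) * (\<Sum>j<n. of_real (A $$ (i, j)) * v $ j))"
    unfolding Q_def by (simp add: sum_distrib_left mult_ac)
  also have "\<dots> = (\<Sum>i<n. cnj (v $ i) * (z * v $ i))"
    by (intro sum.cong) (simp_all add: row)
  also have "\<dots> = z * N"
    unfolding N_def by (simp add: sum_distrib_left mult_ac)
  finally have QN: "Q = z * N" .
  have "cnj Q = (\<Sum>i<n. \<Sum>j<n. of_real (A $$ (i, j)) * v $ i * cnj (v $ j))"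
    unfolding Q_def by simp
  also have "\<dots> = (\<Sum>j<n. \<Sum>i<n. of_real (A $$ (i, j)) * v $ i * cnj (v $ j))"
    by (rule sum.swap)
  also have "\<dots> = Q"
    unfolding Q_def by (intro sum.cong) (simp_all add: entry mult_ac)
  finally have cQ: "cnj Q = Q" .
  have Nr: "N = of_real (\<Sum>i<n. (cmod (v $ i))\<^sup>2)"
    unfolding N_def of_real_sum
    by (intro sum.cong refl) (metis complex_norm_square mult.commute)
  obtain k where k: "k < n" "v $ k \<noteq> 0"
    using v by (metis carrier_vecD eq_vecI index_zero_vec(1,2))
  have "(\<Sum>i<n. (cmod (v $ i))\<^sup>2) > 0"
    using k by (intro sum_pos2[of _ k]) auto
  then have "N \<noteq> 0" unfolding Nr of_real_eq_0_iff by simp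
  have cN: "cnj N = N" unfolding Nr by (rule complex_cnj_complex_of_real)
  from cQ QN cN have "cnj z * N = z * N" by simp
  with \<open>N \<noteq> 0\<close> show ?thesis by (simp add: Reals_cnj_iff)
qed

lemma char_poly_symmetric_splits:
  fixes A :: "real mat"
  assumes A: "A \<in> carrier_mat n n" and sym: "transpose_mat A = A"
  shows "char_poly A = (\<Prod>x\<in>#eigenvalues A. [:- x, 1:])" and "size (eigenvalues A) = n"
proof -
  let ?A = "map_mat of_real A :: complex mat"
  have A': "?A \<in> carrier_mat n n" using A by simp
  obtain as where as: "char_poly ?A = (\<Prod>a\<leftarrow>as. [:- a, 1:])" and len: "length as = n"
    using char_poly_factorized[OF A'] by blast
  have "a \<in> \<real>" if "a \<in> set as" for a
  proof (rule symmetric_real_eigenvalue[OF A sym])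
    have "poly (char_poly ?A) a = 0"
      unfolding as poly_prod_list using that by (auto simp: prod_list_zero_iff)
    then show "eigenvalue ?A a" using eigenvalue_root_char_poly[OF A'] by blast
  qed
  then have "as = map of_real (map Re as)"
    by (auto simp: of_real_Re intro!: map_idI[symmetric])
  then obtain rs where rs: "as = map of_real rs" by blast
  interpret h: map_poly_inj_idom_hom "of_real :: real \<Rightarrow> complex" ..
  have "map_poly of_real (char_poly A) = char_poly ?A"
    by (rule of_real_hom.char_poly_hom[OF A, symmetric])
  also have "\<dots> = map_poly of_real (\<Prod>r\<leftarrow>rs. [:- r, 1:])"
    unfolding as rs by (induction rs) (simp_all add: of_real_hom.map_poly_pCons_hom h.hom_mult del: mult_pCons_left)
  finally have cp: "char_poly A = (\<Prod>r\<leftarrow>rs. [:- r, 1:])"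
    by (rule h.injectivity)
  have "proots (\<Prod>r\<leftarrow>rs. [:- r, 1:]) = mset rs" for rs :: "real list"
  proof (induction rs)
    case (Cons r rs)
    have "(\<Prod>r\<leftarrow>rs. [:- r, 1:]) \<noteq> 0" by (auto simp: prod_list_zero_iff)
    with Cons show ?case by (simp add: proots_mult del: mult_pCons_left)
  qed simp
  then have E: "eigenvalues A = mset rs" unfolding eigenvalues_def cp by simp
  show "size (eigenvalues A) = n" unfolding E using len rs by simp
  show "char_poly A = (\<Prod>x\<in>#eigenvalues A. [:- x, 1:])"
    unfolding E cp by (simp flip: mset_map add: prod_mset_prod_list)
qed

lemma adjacency_symmetric:
  assumes "graph G"
  shows "transpose_mat (adjacency_mat G vs) = adjacency_mat G vs"
    and "transpose_mat (self_loop_adjacency_mat G S vs) = self_loop_adjacency_mat G S vs"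
proof -
  interpret graph G by (rule assms)
  have "u \<rightarrow>\<^bsub>G\<^esub> v \<longleftrightarrow> v \<rightarrow>\<^bsub>G\<^esub> u" for u v
    using sym_arcs unfolding symmetric_def by (auto dest: symD)
  then show "transpose_mat (adjacency_mat G vs) = adjacency_mat G vs"
    and "transpose_mat (self_loop_adjacency_mat G S vs) = self_loop_adjacency_mat G S vs"
    by (auto intro!: eq_matI simp: adjacency_mat_def self_loop_adjacency_mat_def loop_mat_def)
qed

lemma size_eigenvalues_adjacency:
  assumes "graph G"
  shows "size (eigenvalues (adjacency_mat G (vertex_list G))) = card (verts G)"
    and "size (eigenvalues (self_loop_adjacency_mat G S (vertex_list G))) = card (verts G)"
proof -
  interpret graph G by (rule assms)
  have "length (vertex_list G) = card (verts G)"
    using vertex_list[OF finite_verts] by (metis distinct_card)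
  then have "adjacency_mat G (vertex_list G) \<in> carrier_mat (card (verts G)) (card (verts G))"
    and "self_loop_adjacency_mat G S (vertex_list G)
      \<in> carrier_mat (card (verts G)) (card (verts G))"
    by (simp_all add: adjacency_mat_def self_loop_adjacency_mat_def loop_mat_def)
  then show "size (eigenvalues (adjacency_mat G (vertex_list G))) = card (verts G)"
    and "size (eigenvalues (self_loop_adjacency_mat G S (vertex_list G))) = card (verts G)"
    by (simp_all add: char_poly_symmetric_splits(2) adjacency_symmetric[OF assms])
qed

end

theory Submission
  imports Defs
begin

text \<open>
  Write \<open>c = \<sigma> / n\<close> and let \<open>B\<close> be the adjacency matrix of \<open>G \ S\<close>. As \<open>S\<close> is independent, the
  diagonal blocks of \<open>A(G\<^sub>S)\<close> are \<open>I\<^sub>\<sigma>\<close> and \<open>B\<close>. The diagonal of a real symmetric matrix is the image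
  of its spectrum under a doubly stochastic matrix, so the energy of \<open>G\<^sub>S\<close> is at least
  \<open>\<sigma> (1 - c) + \<Sum> \<bar>\<mu> - c\<bar>\<close>, with \<open>\<mu>\<close> ranging over the \<open>n - \<sigma>\<close> eigenvalues of \<open>B\<close>. Since
  \<open>\<sigma> (1 - c) = (n - \<sigma>) c\<close> and \<open>\<bar>\<mu> - c\<bar> + c \<ge> \<bar>\<mu>\<bar>\<close>, this is at least the energy of \<open>G \ S\<close>; the
  inequality is strict because \<open>B\<close> has zero diagonal and hence some eigenvalue \<open>\<mu> \<le> 0 < c\<close>.
\<close>

section \<open>Orthogonal diagonalisation of real symmetric matrices\<close>

text \<open>The characteristic polynomial splits over the reals, so \<open>n > 0\<close> provides a
  real root; an eigenvector for it is then normalised.\<close>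

lemma unit_eigenvector_exists:
  fixes A :: "real mat"
  assumes A: "A \<in> carrier_mat n n" and sym: "transpose_mat A = A" and n: "n > 0"
  obtains e v where "v \<in> carrier_vec n" "v \<bullet> v = 1" "A *\<^sub>v v = e \<cdot>\<^sub>v v"
proof -
  have "eigenvalues A \<noteq> {#}"
    using char_poly_symmetric_splits(2)[OF A sym] n by auto
  then obtain e where "e \<in># eigenvalues A" by blast
  then have "poly (char_poly A) e = 0"
    unfolding char_poly_symmetric_splits(1)[OF A sym] poly_prod_mset
    by (auto simp: prod_mset_zero_iff)
  then have "eigenvalue A e" using eigenvalue_root_char_poly[OF A] by blast
  then obtain u where u: "u \<in> carrier_vec n" "u \<noteq> 0\<^sub>v n" "A *\<^sub>v u = e \<cdot>\<^sub>v u"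
    unfolding eigenvalue_def eigenvector_def using A by auto
  have pos: "u \<bullet> u > 0"
  proof -
    obtain k where k: "k < n" "u $ k \<noteq> 0"
      using u by (metis carrier_vecD eq_vecI index_zero_vec(1,2))
    then show ?thesis
      using u unfolding scalar_prod_def by (intro sum_pos2[of _ k]) auto
  qed
  define v where "v = (1 / sqrt (u \<bullet> u)) \<cdot>\<^sub>v u"
  have "v \<in> carrier_vec n" using u by (simp add: v_def)
  moreover have "v \<bullet> v = 1" using u pos by (simp add: v_def)
  moreover have "A *\<^sub>v v = e \<cdot>\<^sub>v v"
    using u A by (simp add: v_def mult_mat_vec smult_smult_assoc mult.commute)
  ultimately show thesis by (rule that)
qed

text \<open>
  The Householder reflection exchanging \<open>v\<close> and the first unit vector. For \<open>v = e\<^sub>0\<close> the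
  denominator vanishes, and division by zero correctly yields the identity matrix.
\<close>
lemma orthogonal_mat_with_first_col:
  fixes v :: "real vec"
  assumes v: "v \<in> carrier_vec n" and norm: "v \<bullet> v = 1" and n: "n > 0"
  obtains H where "H \<in> carrier_mat n n" "transpose_mat H = H" "H * H = 1\<^sub>m n" "col H 0 = v"
proof -
  define w where "w i = v $ i - (if i = 0 then 1 else 0)" for i
  define s where "s = (\<Sum>i<n. w i * w i)"
  define c where "c = 2 / s"
  define H where "H = mat n n (\<lambda>(i, j). (if i = j then 1 else 0) - c * w i * w j)"
  have vv: "(\<Sum>i<n. v $ i * v $ i) = 1"
    using norm v by (simp add: scalar_prod_def lessThan_atLeast0)
  \<comment> \<open>\<open>s\<close> is the squared length of \<open>w\<close>. As \<open>v\<close>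
    has norm 1, expanding the squares leaves \<open>2 - 2 * v $ 0\<close>, which is what later turns
    the first column of \<open>H\<close> into \<open>v\<close>.\<close>
  have "s = (\<Sum>i<n. v $ i * v $ i - (if i = 0 then 2 * v $ i - 1 else 0))"
    unfolding s_def w_def by (intro sum.cong) (auto simp: algebra_simps)
  then have s: "s = - 2 * w 0"
    using n vv by (simp add: sum_subtractf w_def)
  have H: "H \<in> carrier_mat n n" by (simp add: H_def)
  moreover have "transpose_mat H = H"
    by (intro eq_matI) (auto simp: H_def)
  moreover have "H * H = 1\<^sub>m n"
  proof (intro eq_matI)
    fix i j assume "i < dim_row (1\<^sub>m n :: real mat)" "j < dim_col (1\<^sub>m n :: real mat)"
    then have ij: "i < n" "j < n" by simp_all
    have "(H * H) $$ (i, j) =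
        (\<Sum>k<n. ((if i = k then 1 else 0) - c * w i * w k) * ((if k = j then 1 else 0) - c * w k * w j))"
      using ij H by (simp add: H_def scalar_prod_def lessThan_atLeast0)
    also have "\<dots> = (\<Sum>k<n. (if k = i then (if k = j then 1 else 0) - c * w k * w j else 0)
        - (if k = j then c * w i * w k else 0) + c * c * w i * w j * (w k * w k))"
      by (intro sum.cong) (auto simp: algebra_simps)
    also have "\<dots> = (if i = j then 1 else 0) - 2 * c * w i * w j + c * c * w i * w j * s"
      using ij by (simp add: sum.distrib sum_subtractf s_def sum_distrib_left)
    \<comment> \<open>For \<open>s = 0\<close> both sides vanish, since then
      \<open>c = 2 / 0 = 0\<close>.\<close>
    also have "c * c * w i * w j * s = 2 * c * w i * w j"
      by (simp add: c_def)
    finally show "(H * H) $$ (i, j) = 1\<^sub>m n $$ (i, j)" using ij by simp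
  qed (simp_all add: H_def)
  moreover have "col H 0 = v"
  proof (rule eq_vecI)
    fix i assume "i < dim_vec v"
    then have i: "i < n" using v by simp
    have "c * w i * w 0 = - w i"
    proof (cases "s = 0")
      case True
      then have "w i = 0" using i unfolding s_def by (simp add: sum_nonneg_eq_0_iff)
      then show ?thesis by simp
    qed (simp add: c_def s)
    then show "col H 0 $ i = v $ i" using i n by (simp add: H_def w_def)
  qed (use v in \<open>simp add: H_def\<close>)
  ultimately show thesis by (rule that)
qed

text \<open>Extends an orthogonal change of basis by the identity. It serves the induction step of
  the spectral theorem with \<open>m = 1\<close>, and later fixes the coordinates of the looped
  vertices.\<close>

lemma orthogonal_four_block_one:
  fixes Q :: "real mat" and m n :: nat
  assumes Q: "Q \<in> carrier_mat n n" and orth: "transpose_mat Q * Q = 1\<^sub>m n"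
  defines "W \<equiv> four_block_mat (1\<^sub>m m) (0\<^sub>m m n) (0\<^sub>m n m) Q"
  shows "W \<in> carrier_mat (m + n) (m + n)" and "transpose_mat W * W = 1\<^sub>m (m + n)"
proof -
  have T: "transpose_mat W = four_block_mat (1\<^sub>m m) (0\<^sub>m m n) (0\<^sub>m n m) (transpose_mat Q)"
    unfolding W_def by (subst transpose_four_block_mat) (use Q in auto)
  show "W \<in> carrier_mat (m + n) (m + n)" unfolding W_def using Q by simp
  show "transpose_mat W * W = 1\<^sub>m (m + n)"
    unfolding T unfolding W_def
    by (subst mult_four_block_mat[of _ m m _ n _ n]) (use Q orth in auto)
qed

text \<open>Block multiplication: the block \<open>E\<close> survives unchanged while the lower
  right block is conjugated by \<open>Q\<close>, so the latter can be diagonalised without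
  disturbing the former.\<close>

lemma conj_four_block_one:
  fixes A Q :: "real mat" and m n :: nat
  assumes Q: "Q \<in> carrier_mat n n" and A: "A \<in> carrier_mat n n"
    and E: "E \<in> carrier_mat m m" and C: "C \<in> carrier_mat m n" and C': "C' \<in> carrier_mat n m"
  defines "W \<equiv> four_block_mat (1\<^sub>m m) (0\<^sub>m m n) (0\<^sub>m n m) Q"
  shows "transpose_mat W * four_block_mat E C C' A * W =
    four_block_mat E (C * Q) (transpose_mat Q * C') (transpose_mat Q * A * Q)"
proof -
  have T: "transpose_mat W = four_block_mat (1\<^sub>m m) (0\<^sub>m m n) (0\<^sub>m n m) (transpose_mat Q)"
    unfolding W_def by (subst transpose_four_block_mat) (use Q in auto)
  have "transpose_mat W * four_block_mat E C C' A =
    four_block_mat E C (transpose_mat Q * C') (transpose_mat Q * A)"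
    unfolding T by (subst mult_four_block_mat[of _ m m _ n _ n]) (use assms in auto)
  then show ?thesis unfolding W_def
    by (simp, subst mult_four_block_mat[of _ m m _ n _ n]) (use assms in auto)
qed

lemma transpose_conj_symmetric:
  fixes A :: "'r :: comm_ring_1 mat"
  assumes A: "A \<in> carrier_mat n n" and W: "W \<in> carrier_mat n m" and sym: "transpose_mat A = A"
  shows "transpose_mat (transpose_mat W * A * W) = transpose_mat W * A * W"
proof -
  have "transpose_mat (transpose_mat W * A * W) = transpose_mat W * transpose_mat (transpose_mat W * A)"
    by (rule transpose_mult) (use A W in auto)
  also have "transpose_mat (transpose_mat W * A) = transpose_mat A * W"
    using transpose_mult[of "transpose_mat W" m n A n] A W by simp
  finally show ?thesis using A W sym by (simp add: assoc_mult_mat[of _ m n _ n _ m])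
qed

text \<open>Induction by deflation: a reflection \<open>H\<close> moves a unit eigenvector to the
  first coordinate, which splits off its eigenvalue, and the remaining symmetric block is
  diagonalised by the induction hypothesis.\<close>

lemma spectral_theorem_real_symmetric:
  fixes A :: "real mat"
  assumes "A \<in> carrier_mat n n" and "transpose_mat A = A"
  obtains Q d where "Q \<in> carrier_mat n n" "transpose_mat Q * Q = 1\<^sub>m n"
    "transpose_mat Q * A * Q = mat_diag n d"
proof -
  have "\<exists>Q d. Q \<in> carrier_mat n n \<and> transpose_mat Q * Q = 1\<^sub>m n \<and>
    transpose_mat Q * A * Q = mat_diag n d"
    using assms
  proof (induction n arbitrary: A)
    case 0
    then show ?case by (intro exI[of _ "1\<^sub>m 0"] exI) (auto simp: mat_diag_def)
  next
    case (Suc n)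
    note A = Suc.prems(1) and sym = Suc.prems(2)
    obtain e v where v: "v \<in> carrier_vec (Suc n)" "v \<bullet> v = 1" and ev: "A *\<^sub>v v = e \<cdot>\<^sub>v v"
      using unit_eigenvector_exists[OF A sym] by blast
    obtain H where H: "H \<in> carrier_mat (Suc n) (Suc n)" and symH: "transpose_mat H = H"
      and HH: "H * H = 1\<^sub>m (Suc n)" and col: "col H 0 = v"
      using orthogonal_mat_with_first_col[OF v] by blast
    define N where "N = H * A * H"
    have N: "N \<in> carrier_mat (Suc n) (Suc n)" using A H by (simp add: N_def)
    have symN: "transpose_mat N = N"
      using transpose_conj_symmetric[OF A H sym] by (simp add: N_def symH)
    have Nsym: "N $$ (i, j) = N $$ (j, i)" if "i < Suc n" "j < Suc n" for i j
      using that N arg_cong[OF symN, of "\<lambda>M. M $$ (i, j)"] by simp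
    \<comment> \<open>\<open>H\<close> maps the first unit vector to the eigenvector
      \<open>v\<close> and, being an involution, maps \<open>v\<close> back. Hence the first column
      of \<open>N\<close> is \<open>e\<close> times the first unit vector, and symmetry clears the
      first row too.\<close>
    have "col N 0 = (H * A) *\<^sub>v v"
      unfolding N_def by (subst col_mult2[of _ "Suc n" "Suc n"]) (use A H col in auto)
    also have "\<dots> = H *\<^sub>v (e \<cdot>\<^sub>v v)"
      using A H v by (simp add: ev assoc_mult_mat_vec[of _ "Suc n" "Suc n" _ "Suc n"])
    also have "\<dots> = e \<cdot>\<^sub>v (H *\<^sub>v col H 0)"
      using H v by (simp add: mult_mat_vec col)
    also have "H *\<^sub>v col H 0 = col (H * H) 0"
      by (rule col_mult2[symmetric, of _ "Suc n" "Suc n" _ "Suc n"]) (use H in auto)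
    finally have colN: "col N 0 = e \<cdot>\<^sub>v unit_vec (Suc n) 0" by (simp add: HH)
    have N0: "N $$ (i, 0) = (if i = 0 then e else 0)" if "i < Suc n" for i
      using arg_cong[OF colN, of "\<lambda>x. x $ i"] that N by simp
    define B where "B = mat n n (\<lambda>(i, j). N $$ (Suc i, Suc j))"
    have B: "B \<in> carrier_mat n n" by (simp add: B_def)
    have "transpose_mat B = B" by (intro eq_matI) (auto simp: B_def Nsym)
    from Suc.IH[OF B this] obtain Q d where Q: "Q \<in> carrier_mat n n"
      and orth: "transpose_mat Q * Q = 1\<^sub>m n" and D: "transpose_mat Q * B * Q = mat_diag n d"
      by blast
    have Nb: "N = four_block_mat (mat 1 1 (\<lambda>_. e)) (0\<^sub>m 1 n) (0\<^sub>m n 1) B"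
    proof (rule eq_matI)
      fix i j assume "i < dim_row (four_block_mat (mat 1 1 (\<lambda>_. e)) (0\<^sub>m 1 n) (0\<^sub>m n 1) B)"
        "j < dim_col (four_block_mat (mat 1 1 (\<lambda>_. e)) (0\<^sub>m 1 n) (0\<^sub>m n 1) B)"
      then have "i < Suc n" "j < Suc n" using B by auto
      then show "N $$ (i, j) = four_block_mat (mat 1 1 (\<lambda>_. e)) (0\<^sub>m 1 n) (0\<^sub>m n 1) B $$ (i, j)"
        using N0[of i] N0[of j] Nsym[of 0 j]
        by (cases i; cases j) (auto simp: B_def)
    qed (use N B in auto)
    define W where "W = four_block_mat (1\<^sub>m 1) (0\<^sub>m 1 n) (0\<^sub>m n 1) Q"
    have W: "W \<in> carrier_mat (Suc n) (Suc n)" and WW: "transpose_mat W * W = 1\<^sub>m (Suc n)"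
      using orthogonal_four_block_one[OF Q orth, of 1] by (simp_all add: W_def)
    \<comment> \<open>\<open>case_nat e d\<close> puts \<open>e\<close> at index 0 and shifts
      \<open>d\<close> by one.\<close>
    have WNW: "transpose_mat W * N * W = mat_diag (Suc n) (case_nat e d)"
    proof -
      have "transpose_mat W * N * W =
          four_block_mat (mat 1 1 (\<lambda>_. e)) (0\<^sub>m 1 n * Q) (transpose_mat Q * 0\<^sub>m n 1) (mat_diag n d)"
        unfolding Nb W_def D[symmetric] by (rule conj_four_block_one) (use Q B in auto)
      also have "\<dots> = mat_diag (Suc n) (case_nat e d)"
        using Q by (intro eq_matI) (auto simp: mat_diag_def less_Suc_eq_0_disj split: if_splits)
      finally show ?thesis .
    qed
    have T: "transpose_mat (H * W) = transpose_mat W * H"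
      using transpose_mult[OF H W] by (simp add: symH)
    have "transpose_mat (H * W) * (H * W) = transpose_mat W * ((H * H) * W)"
      unfolding T using H W by (simp add: assoc_mult_mat[of _ "Suc n" "Suc n" _ "Suc n" _ "Suc n"])
    then have "transpose_mat (H * W) * (H * W) = 1\<^sub>m (Suc n)"
      using W WW by (simp add: HH)
    moreover have "transpose_mat (H * W) * A * (H * W) = transpose_mat W * N * W"
      unfolding T N_def using A H W
      by (simp add: assoc_mult_mat[of _ "Suc n" "Suc n" _ "Suc n" _ "Suc n"])
    ultimately show ?case
      using WNW H W by (intro exI[of _ "H * W"] exI[of _ "case_nat e d"]) simp
  qed
  then show thesis using that by blast
qed

section \<open>Comparing the diagonal of a symmetric matrix with its spectrum\<close>

lemma eigenvalues_orthogonal_conj: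
  fixes A :: "real mat"
  assumes A: "A \<in> carrier_mat n n" and W: "W \<in> carrier_mat n n"
    and orth: "transpose_mat W * W = 1\<^sub>m n"
  shows "eigenvalues (transpose_mat W * A * W) = eigenvalues A"
proof -
  have "W * transpose_mat W = 1\<^sub>m n"
    by (rule mat_mult_left_right_inverse[OF _ W orth]) (use W in simp)
  then have "similar_mat_wit (transpose_mat W * A * W) A (transpose_mat W) W"
    by (intro similar_mat_witI[OF orth]) (use A W in auto)
  then have "similar_mat (transpose_mat W * A * W) A" unfolding similar_mat_def by blast
  then show ?thesis unfolding eigenvalues_def by (simp add: char_poly_similar)
qed

lemma eigenvalues_mat_diag: "eigenvalues (mat_diag n d) = image_mset d (mset_set {..<n})"
proof -
  have "upper_triangular (mat_diag n d)" by (auto simp: mat_diag_def)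
  then have cp: "char_poly (mat_diag n d) = (\<Prod>x\<leftarrow>map d [0..<n]. [:- x, 1:])"
    by (subst char_poly_upper_triangular[of _ n])
       (auto simp: diag_mat_def mat_diag_def intro!: arg_cong[of _ _ prod_list])
  have "proots (\<Prod>x\<leftarrow>xs. [:- x, 1:]) = mset xs" for xs :: "real list"
  proof (induction xs)
    case (Cons x xs)
    have "(\<Prod>x\<leftarrow>xs. [:- x, 1:]) \<noteq> 0" by (auto simp: prod_list_zero_iff)
    with Cons show ?case by (simp add: proots_mult del: mult_pCons_left)
  qed simp
  then have "eigenvalues (mat_diag n d) = mset (map d [0..<n])" unfolding eigenvalues_def cp .
  then show ?thesis by (simp add: lessThan_atLeast0)
qed

text \<open>The squared entries of the diagonalising matrix form a doubly stochastic matrix.\<close>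
lemma diagonal_eq_doubly_stochastic_eigenvalues:
  fixes A :: "real mat"
  assumes A: "A \<in> carrier_mat n n" and sym: "transpose_mat A = A"
  obtains p d where "\<And>i k. p i k \<ge> (0 :: real)"
    "\<And>i. i < n \<Longrightarrow> (\<Sum>k<n. p i k) = 1" "\<And>k. k < n \<Longrightarrow> (\<Sum>i<n. p i k) = 1"
    "\<And>i. i < n \<Longrightarrow> A $$ (i, i) = (\<Sum>k<n. p i k * d k)"
    "eigenvalues A = image_mset d (mset_set {..<n})"
proof -
  obtain Q d where Q: "Q \<in> carrier_mat n n" and orth: "transpose_mat Q * Q = 1\<^sub>m n"
    and D: "transpose_mat Q * A * Q = mat_diag n d"
    using spectral_theorem_real_symmetric[OF A sym] by blast
  have orth': "Q * transpose_mat Q = 1\<^sub>m n"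
    by (rule mat_mult_left_right_inverse[OF _ Q orth]) (use Q in simp)
  have "A = (Q * transpose_mat Q) * A * (Q * transpose_mat Q)"
    using A by (simp add: orth')
  also have "\<dots> = Q * (transpose_mat Q * A * Q) * transpose_mat Q"
    using A Q by (simp add: assoc_mult_mat[of _ n n _ n _ n])
  finally have AQ: "A = Q * mat_diag n d * transpose_mat Q" unfolding D .
  define p where "p i k = (Q $$ (i, k))\<^sup>2" for i k
  show thesis
  proof (rule that[of p d])
    show "p i k \<ge> 0" for i k by (simp add: p_def)
    show "(\<Sum>k<n. p i k) = 1" if "i < n" for i
      using arg_cong[OF orth', of "\<lambda>M. M $$ (i, i)"] that Q
      by (simp add: p_def scalar_prod_def lessThan_atLeast0 power2_eq_square)
    show "(\<Sum>i<n. p i k) = 1" if "k < n" for k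
      using arg_cong[OF orth, of "\<lambda>M. M $$ (k, k)"] that Q
      by (simp add: p_def scalar_prod_def lessThan_atLeast0 power2_eq_square)
    show "A $$ (i, i) = (\<Sum>k<n. p i k * d k)" if "i < n" for i
      using arg_cong[OF AQ, of "\<lambda>M. M $$ (i, i)"] that Q
      by (simp add: mat_diag_mult_right[OF Q] p_def scalar_prod_def lessThan_atLeast0
          power2_eq_square mult_ac)
    show "eigenvalues A = image_mset d (mset_set {..<n})"
      using eigenvalues_orthogonal_conj[OF A Q orth] by (simp add: D eigenvalues_mat_diag)
  qed
qed

text \<open>Since the rows of \<open>p\<close> sum to 1, each \<open>A $$ (i, i) - c\<close> is a
  convex combination of the numbers \<open>d k - c\<close>. The triangle inequality bounds its
  absolute value, and column sums 1 collapse the total.\<close>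

lemma sum_abs_diagonal_le_eigenvalues:
  fixes A :: "real mat"
  assumes A: "A \<in> carrier_mat n n" and sym: "transpose_mat A = A"
  shows "(\<Sum>i<n. \<bar>A $$ (i, i) - c\<bar>) \<le> (\<Sum>x\<in>#eigenvalues A. \<bar>x - c\<bar>)"
proof -
  obtain p d where p: "\<And>i k. p i k \<ge> (0 :: real)"
    and row: "\<And>i. i < n \<Longrightarrow> (\<Sum>k<n. p i k) = 1" and col: "\<And>k. k < n \<Longrightarrow> (\<Sum>i<n. p i k) = 1"
    and diag: "\<And>i. i < n \<Longrightarrow> A $$ (i, i) = (\<Sum>k<n. p i k * d k)"
    and ev: "eigenvalues A = image_mset d (mset_set {..<n})"
    using diagonal_eq_doubly_stochastic_eigenvalues[OF A sym] by blast
  have "(\<Sum>i<n. \<bar>A $$ (i, i) - c\<bar>) \<le> (\<Sum>i<n. \<Sum>k<n. p i k * \<bar>d k - c\<bar>)"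
  proof (rule sum_mono)
    fix i assume "i \<in> {..<n}"
    then have i: "i < n" by simp
    have "A $$ (i, i) - c = (\<Sum>k<n. p i k * d k) - c * (\<Sum>k<n. p i k)"
      using i by (simp add: diag row)
    also have "\<dots> = (\<Sum>k<n. p i k * (d k - c))"
      by (simp add: right_diff_distrib sum_subtractf sum_distrib_left mult.commute)
    also have "\<bar>\<dots>\<bar> \<le> (\<Sum>k<n. \<bar>p i k * (d k - c)\<bar>)" by (rule sum_abs)
    finally show "\<bar>A $$ (i, i) - c\<bar> \<le> (\<Sum>k<n. p i k * \<bar>d k - c\<bar>)"
      using p by (simp add: abs_mult)
  qed
  also have "\<dots> = (\<Sum>k<n. (\<Sum>i<n. p i k) * \<bar>d k - c\<bar>)"
    by (subst sum.swap) (simp add: sum_distrib_right)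
  also have "\<dots> = (\<Sum>k<n. \<bar>d k - c\<bar>)" by (simp add: col)
  finally show ?thesis by (simp add: ev sum_unfold_sum_mset image_mset.compositionality o_def)
qed

text \<open>A diagonal entry is a weighted average of the eigenvalues, so they cannot all exceed
  it.\<close>

lemma exists_eigenvalue_le_diagonal:
  fixes A :: "real mat"
  assumes A: "A \<in> carrier_mat n n" and sym: "transpose_mat A = A" and i: "i < n"
  shows "\<exists>x\<in>#eigenvalues A. x \<le> A $$ (i, i)"
proof -
  obtain p d where p: "\<And>i k. p i k \<ge> (0 :: real)"
    and row: "\<And>i. i < n \<Longrightarrow> (\<Sum>k<n. p i k) = 1" and "\<And>k. k < n \<Longrightarrow> (\<Sum>i<n. p i k) = 1"
    and diag: "\<And>i. i < n \<Longrightarrow> A $$ (i, i) = (\<Sum>k<n. p i k * d k)"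
    and ev: "eigenvalues A = image_mset d (mset_set {..<n})"
    using diagonal_eq_doubly_stochastic_eigenvalues[OF A sym] by blast
  have "\<exists>k<n. d k \<le> A $$ (i, i)"
  proof (rule ccontr)
    assume "\<not> (\<exists>k<n. d k \<le> A $$ (i, i))"
    then have gt: "d k > A $$ (i, i)" if "k < n" for k using that by (meson not_le)
    obtain k where k: "k < n" "p i k \<noteq> 0"
      using row[OF i] by (metis lessThan_iff sum.neutral zero_neq_one)
    then have "p i k > 0" using p[of i k] by simp
    have "0 < (\<Sum>k<n. p i k * (d k - A $$ (i, i)))"
      using p gt k \<open>p i k > 0\<close>
      by (intro sum_pos2[of _ k]) (auto simp: zero_le_mult_iff zero_less_mult_iff less_imp_le)
    also have "\<dots> = (\<Sum>k<n. p i k * d k) - A $$ (i, i) * (\<Sum>k<n. p i k)"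
      by (simp add: right_diff_distrib sum_subtractf sum_distrib_left sum_distrib_right mult.commute)
    also have "\<dots> = 0" using i by (simp add: row flip: diag)
    finally show False by simp
  qed
  then show ?thesis by (auto simp: ev)
qed

text \<open>
  After an orthogonal change of basis diagonalising \<open>B\<close>, the diagonal of the block matrix consists of
  the eigenvalues of its two diagonal blocks.
\<close>
lemma sum_abs_block_eigenvalues_le:
  fixes B C :: "real mat"
  assumes B: "B \<in> carrier_mat n n" and sym: "transpose_mat B = B" and C: "C \<in> carrier_mat m n"
  shows "real m * \<bar>1 - c\<bar> + (\<Sum>x\<in>#eigenvalues B. \<bar>x - c\<bar>) \<le>
    (\<Sum>x\<in>#eigenvalues (four_block_mat (1\<^sub>m m) C (transpose_mat C) B). \<bar>x - c\<bar>)"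
proof -
  obtain Q d where Q: "Q \<in> carrier_mat n n" and orth: "transpose_mat Q * Q = 1\<^sub>m n"
    and D: "transpose_mat Q * B * Q = mat_diag n d"
    using spectral_theorem_real_symmetric[OF B sym] by blast
  have ev: "eigenvalues B = image_mset d (mset_set {..<n})"
    using eigenvalues_orthogonal_conj[OF B Q orth] by (simp add: D eigenvalues_mat_diag)
  define M where "M = four_block_mat (1\<^sub>m m) C (transpose_mat C) B"
  define W where "W = four_block_mat (1\<^sub>m m) (0\<^sub>m m n) (0\<^sub>m n m) Q"
  define N where "N = transpose_mat W * M * W"
  have M: "M \<in> carrier_mat (m + n) (m + n)" using B by (simp add: M_def)
  have symM: "transpose_mat M = M"
    unfolding M_def by (subst transpose_four_block_mat) (use B C sym in auto)
  have W: "W \<in> carrier_mat (m + n) (m + n)" and WW: "transpose_mat W * W = 1\<^sub>m (m + n)"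
    using orthogonal_four_block_one[OF Q orth, of m] by (simp_all add: W_def)
  have N: "N \<in> carrier_mat (m + n) (m + n)" using M W by (simp add: N_def)
  \<comment> \<open>The off-diagonal blocks need not vanish; only the diagonal of \<open>N\<close>
    enters the estimate, and \<open>N\<close> has the spectrum of \<open>M\<close>.\<close>
  have Nb: "N = four_block_mat (1\<^sub>m m) (C * Q) (transpose_mat Q * transpose_mat C) (mat_diag n d)"
    unfolding N_def M_def W_def D[symmetric]
    by (rule conj_four_block_one) (use Q B C in auto)
  have sum_split: "(\<Sum>i<m + k. f i) = (\<Sum>i<m. f i) + (\<Sum>i<k. f (m + i))" for f :: "nat \<Rightarrow> real" and k
    by (induction k) auto
  have "(\<Sum>i<m + n. \<bar>N $$ (i, i) - c\<bar>) = (\<Sum>i<m. \<bar>N $$ (i, i) - c\<bar>) + (\<Sum>i<n. \<bar>N $$ (m + i, m + i) - c\<bar>)"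
    by (rule sum_split)
  also have "\<dots> = real m * \<bar>1 - c\<bar> + (\<Sum>i<n. \<bar>d i - c\<bar>)"
    by (simp add: Nb mat_diag_def)
  finally show ?thesis
    using sum_abs_diagonal_le_eigenvalues[OF N, of c] transpose_conj_symmetric[OF M W symM]
      eigenvalues_orthogonal_conj[OF M W WW]
    by (simp add: N_def M_def ev sum_unfold_sum_mset image_mset.compositionality o_def)
qed

section \<open>The shift by \<open>c\<close> and the adjacency matrices\<close>

text \<open>Termwise |y| \<le> |y - c| + c. At \<open>x\<close> the right side is |x| + 2c, which
  makes the inequality strict.\<close>

lemma sum_mset_abs_less_shift:
  fixes X :: "real multiset"
  assumes c: "c > 0" and x: "x \<in># X" "x \<le> 0"
  shows "(\<Sum>y\<in>#X. \<bar>y\<bar>) < (\<Sum>y\<in>#X. \<bar>y - c\<bar>) + real (size X) * c"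
proof -
  obtain Y where X: "X = add_mset x Y" using x by (metis multi_member_split)
  have "(\<Sum>y\<in>#Y. \<bar>y\<bar>) \<le> (\<Sum>y\<in>#Y. \<bar>y - c\<bar> + c)"
    using c by (intro sum_mset_mono) auto
  also have "\<dots> = (\<Sum>y\<in>#Y. \<bar>y - c\<bar>) + real (size Y) * c"
    by (simp add: sum_mset.distrib)
  finally show ?thesis using c x by (simp add: X algebra_simps)
qed

text \<open>An induced subgraph keeps every arc between surviving vertices. This identifies the
  matrix of the deleted graph with a block of the matrix of \<open>G\<close>.\<close>

lemma adjacency_mat_delete_verts:
  assumes "set vs \<subseteq> verts G - S"
  shows "adjacency_mat (delete_verts G S) vs = adjacency_mat G vs"
proof (intro eq_matI)
  fix i j assume "i < dim_row (adjacency_mat G vs)" "j < dim_col (adjacency_mat G vs)"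
  then have ij: "i < length vs" "j < length vs" by (simp_all add: adjacency_mat_def)
  then have "vs ! i \<in> verts G - S" "vs ! j \<in> verts G - S" using assms nth_mem by blast+
  then have "vs ! i \<rightarrow>\<^bsub>delete_verts G S\<^esub> vs ! j \<longleftrightarrow> vs ! i \<rightarrow>\<^bsub>G\<^esub> vs ! j"
    by (auto simp: delete_verts_def arcs_ends_def arc_to_ends_def image_iff)
  then show "adjacency_mat (delete_verts G S) vs $$ (i, j) = adjacency_mat G vs $$ (i, j)"
    using ij by (simp add: adjacency_mat_def)
qed (simp_all add: adjacency_mat_def)

text \<open>Listing \<open>S\<close> first exposes the blocks: independence leaves only the loops
  among the vertices of \<open>S\<close>, giving an identity block, no loop sits at a vertex of
  \<open>ts\<close>, and symmetry of adjacency relates the mixed blocks.\<close>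

lemma self_loop_adjacency_mat_append:
  assumes G: "graph G" and indep: "independent_set G S"
    and d: "distinct ss" "set ss = S" "set ts \<inter> S = {}"
  obtains C where "C \<in> carrier_mat (length ss) (length ts)"
    "self_loop_adjacency_mat G S (ss @ ts) =
      four_block_mat (1\<^sub>m (length ss)) C (transpose_mat C) (adjacency_mat G ts)"
proof -
  interpret graph G by (rule G)
  have sym: "u \<rightarrow>\<^bsub>G\<^esub> v \<longleftrightarrow> v \<rightarrow>\<^bsub>G\<^esub> u" for u v
    using sym_arcs unfolding symmetric_def by (auto dest: symD)
  have na: "\<not> u \<rightarrow>\<^bsub>G\<^esub> v" if "u \<in> set ss" "v \<in> set ss" for u v
    using indep that d unfolding independent_set_def by blast
  have notS: "ts ! k \<notin> S" if "k < length ts" for k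
    using d that nth_mem by blast
  define C :: "real mat" where
    "C = mat (length ss) (length ts) (\<lambda>(i, j). if ss ! i \<rightarrow>\<^bsub>G\<^esub> ts ! j then 1 else 0)"
  show thesis
  proof (rule that[of C])
    show "C \<in> carrier_mat (length ss) (length ts)" by (simp add: C_def)
    show "self_loop_adjacency_mat G S (ss @ ts) =
      four_block_mat (1\<^sub>m (length ss)) C (transpose_mat C) (adjacency_mat G ts)"
      using d na
      by (intro eq_matI)
         (auto simp: self_loop_adjacency_mat_def adjacency_mat_def loop_mat_def C_def
           nth_append nth_eq_iff_index_eq notS sym[of "ts ! _" "ss ! _"])
  qed
qed

theorem theorem2p2:
  fixes G :: "('a, 'b) pre_digraph" and S :: "'a set" and n \<sigma> :: nat
  assumes "graph G"
    and "card (verts G) = n" and "n \<ge> 2"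
    and "independent_set G S"
    and "card S = \<sigma>" and "1 \<le> \<sigma>" and "\<sigma> \<le> n - 1"
  shows "graph_energy (delete_verts G S) < self_loop_energy G S"
proof -
  interpret graph G by (rule assms)
  have SG: "S \<subseteq> verts G" using assms(4) by (simp add: independent_set_def)
  then have "finite S" by (rule finite_subset) simp
  then obtain ss where ss: "distinct ss" "set ss = S" using finite_distinct_list by blast
  \<comment> \<open>This is the enumeration that \<open>graph_energy\<close> itself uses for the
    deleted graph, so only the enumeration of \<open>G\<close> has to be changed later.\<close>
  define ts where "ts = vertex_list (delete_verts G S)"
  have V: "verts (delete_verts G S) = verts G - S" by (simp add: delete_verts_def)
  have ts: "distinct ts" "set ts = verts G - S"
    using vertex_list[of "delete_verts G S"] by (simp_all add: ts_def V)
  define m where "m = n - \<sigma>"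
  have ls: "length ss = \<sigma>" using ss assms(5) distinct_card by fastforce
  have lt: "length ts = m"
    using ts SG \<open>finite S\<close> assms(2,5) by (metis card_Diff_subset distinct_card m_def)
  have m: "m > 0" "n = \<sigma> + m" using assms(3,6,7) by (auto simp: m_def)
  define c where "c = real \<sigma> / real n"
  have c: "c > 0" "real \<sigma> * \<bar>1 - c\<bar> = real m * c"
    using assms(6) m by (simp_all add: c_def field_simps abs_if)
  define B where "B = adjacency_mat G ts"
  have B: "B \<in> carrier_mat m m" by (simp add: B_def adjacency_mat_def lt)
  have symB: "transpose_mat B = B" unfolding B_def by (rule adjacency_symmetric[OF assms(1)])
  obtain C where C: "C \<in> carrier_mat \<sigma> m" and
    M: "self_loop_adjacency_mat G S (ss @ ts) = four_block_mat (1\<^sub>m \<sigma>) C (transpose_mat C) B"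
    using self_loop_adjacency_mat_append[OF assms(1,4) ss, of ts] ts by (auto simp: ls lt B_def)
  have "\<not> ts ! 0 \<rightarrow>\<^bsub>G\<^esub> ts ! 0" using adj_not_same by blast
  then have "B $$ (0, 0) = 0" using m by (simp add: B_def adjacency_mat_def lt)
  then obtain x where x: "x \<in># eigenvalues B" "x \<le> 0"
    using exists_eigenvalue_le_diagonal[OF B symB, of 0] m by auto
  have "graph_energy (delete_verts G S) = (\<Sum>y\<in>#eigenvalues B. \<bar>y\<bar>)"
    unfolding graph_energy_def B_def ts_def[symmetric]
    by (simp add: adjacency_mat_delete_verts ts)
  also have "\<dots> < (\<Sum>y\<in>#eigenvalues B. \<bar>y - c\<bar>) + real m * c"
    using sum_mset_abs_less_shift[OF c(1) x] char_poly_symmetric_splits(2)[OF B symB] by simp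
  \<comment> \<open>The total cost of shifting the \<open>m\<close> eigenvalues of \<open>B\<close>
    by \<open>c\<close> is exactly the contribution of the \<open>\<sigma>\<close> loops, because
    \<open>n = \<sigma> + m\<close>.\<close>
  also have "\<dots> = real \<sigma> * \<bar>1 - c\<bar> + (\<Sum>y\<in>#eigenvalues B. \<bar>y - c\<bar>)"
    using c by simp
  also have "\<dots> \<le> (\<Sum>y\<in>#eigenvalues (self_loop_adjacency_mat G S (ss @ ts)). \<bar>y - c\<bar>)"
    unfolding M by (rule sum_abs_block_eigenvalues_le[OF B symB C])
  \<comment> \<open>Both lists enumerate the vertices of \<open>G\<close>, and the characteristic
    polynomial is independent of the enumeration.\<close>
  also have "eigenvalues (self_loop_adjacency_mat G S (ss @ ts)) =
      eigenvalues (self_loop_adjacency_mat G S (vertex_list G))"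
    unfolding eigenvalues_def using vertex_list[of G] ss ts SG
    by (subst char_poly_adjacency_enum(2)[of _ "vertex_list G"]) auto
  finally show ?thesis unfolding self_loop_energy_def c_def assms(2,5) .
qed

end
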